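(* For all positive integers $r$, $k$ and $\ell$ with $1\leq \ell< k/r$, we have \[\operatorname{ind}_r(k,\ell)\leq \operatorname{ind}_{\leq r}(k,\ell)\leq \frac{k}{k-r\ell}\cdot \frac{1}{e}.\]
   Context: A hypergraph has a finite vertex set and a set of edges, each edge being a non-empty subset of the vertex set. For a hypergraph $G$ with at least $k$ vertices, let $I(G,k,\ell)$ be the probability that a uniformly random $k$-vertex subset of $V(G)$ contains (as subsets) exactly $\ell$ edges of $G$. For $r\geq 1$, $0\le \ell\le\binom{k}{r}$ and $n\geq k$, let $I_r(n,k,\ell)$ be the maximum of $I(G,k,\ell)$ over all $r$-uniform hypergraphs $G$ on $n$ vertices, and $I_{\leq r}(n,k,\ell)$ the maximum of $I(G,k,\ell)$ over all hypergraphs $G$ on $n$ vertices all of whose edges have size at most $r$. Both are non-increasing in $n$; define $\operatorname{ind}_r(k,\ell)=\lim_{n\to\infty}I_r(n,k,\ell)$ and $\operatorname{ind}_{\leq r}(k,\ell)=\lim_{n\to\infty}I_{\leq r}(n,k,\ell)$. *)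

theory Defs
  imports "HOL-Probability.Probability"
begin

definition hypergraph :: "'a set \<Rightarrow> 'a set set \<Rightarrow> bool" where
  "hypergraph V E \<longleftrightarrow> finite V \<and> (\<forall>e\<in>E. e \<subseteq> V \<and> e \<noteq> {})"

definition uniform_edges :: "nat \<Rightarrow> 'a set set \<Rightarrow> bool" where
  "uniform_edges r E \<longleftrightarrow> (\<forall>e\<in>E. card e = r)"

definition edges_size_le :: "nat \<Rightarrow> 'a set set \<Rightarrow> bool" where
  "edges_size_le r E \<longleftrightarrow> (\<forall>e\<in>E. card e \<le> r)"

text \<open>Meaningful only if \<open>V\<close> is finite with at least \<open>k\<close> elements; otherwise the
  argument of \<^const>\<open>pmf_of_set\<close> is empty or infinite.\<close>

definition I_prob :: "'a set \<Rightarrow> 'a set set \<Rightarrow> nat \<Rightarrow> nat \<Rightarrow> real" where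
  "I_prob V E k l =
     measure_pmf.prob (pmf_of_set {S. S \<subseteq> V \<and> card S = k}) {S. card {e \<in> E. e \<subseteq> S} = l}"

text \<open>Every finite hypergraph is isomorphic to one whose vertices are natural numbers,
  so the maxima range over all hypergraphs on \<open>n\<close> vertices up to isomorphism.
  The values for \<open>n < k\<close> are irrelevant to the limits below.\<close>

definition I_unif :: "nat \<Rightarrow> nat \<Rightarrow> nat \<Rightarrow> nat \<Rightarrow> real" where
  "I_unif r n k l =
     Max {I_prob V E k l | (V :: nat set) E. hypergraph V E \<and> card V = n \<and> uniform_edges r E}"

definition I_le :: "nat \<Rightarrow> nat \<Rightarrow> nat \<Rightarrow> nat \<Rightarrow> real" where
  "I_le r n k l =
     Max {I_prob V E k l | (V :: nat set) E. hypergraph V E \<and> card V = n \<and> edges_size_le r E}"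

definition ind_unif :: "nat \<Rightarrow> nat \<Rightarrow> nat \<Rightarrow> real" where
  "ind_unif r k l = lim (\<lambda>n. I_unif r n k l)"

definition ind_le :: "nat \<Rightarrow> nat \<Rightarrow> nat \<Rightarrow> real" where
  "ind_le r k l = lim (\<lambda>n. I_le r n k l)"

text \<open>For \<open>n \<ge> k\<close> the sets under \<^const>\<open>Max\<close> are finite and non-empty, and the limits
  exist. The two cases are treated together, with \<open>Q\<close> the condition on the edge sizes.\<close>

definition I_values :: "(nat \<Rightarrow> bool) \<Rightarrow> nat \<Rightarrow> nat \<Rightarrow> nat \<Rightarrow> real set" where
  "I_values Q n k l =
     {I_prob V E k l | (V :: nat set) E. hypergraph V E \<and> card V = n \<and> (\<forall>e\<in>E. Q (card e))}"

lemma I_unif_eq: "I_unif r n k l = Max (I_values (\<lambda>s. s = r) n k l)"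
  by (simp add: I_unif_def I_values_def uniform_edges_def)

lemma I_le_eq: "I_le r n k l = Max (I_values (\<lambda>s. s \<le> r) n k l)"
  by (simp add: I_le_def I_values_def edges_size_le_def)

lemma I_prob_eq:
  assumes "finite V" "k \<le> card V"
  shows "I_prob V E k l =
    card {S. S \<subseteq> V \<and> card S = k \<and> card {e \<in> E. e \<subseteq> S} = l} / (card V choose k)"
proof -
  let ?A = "{S. S \<subseteq> V \<and> card S = k}"
  have fin: "finite ?A" using assms(1) by auto
  have ne: "?A \<noteq> {}" using obtain_subset_with_card_n[OF assms(2)] by blast
  have "?A \<inter> {S. card {e \<in> E. e \<subseteq> S} = l} =
      {S. S \<subseteq> V \<and> card S = k \<and> card {e \<in> E. e \<subseteq> S} = l}" by auto
  then show ?thesis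
    unfolding I_prob_def using fin ne assms(1) by (simp add: measure_pmf_of_set n_subsets)
qed

lemma I_values_nonempty: "I_values Q n k l \<noteq> {}"
proof -
  have "I_prob {..<n} {} k l \<in> I_values Q n k l"
    unfolding I_values_def hypergraph_def
    by (rule CollectI, rule exI[of _ "{..<n}"], rule exI[of _ "{}"]) simp
  then show ?thesis by blast
qed

lemma finite_I_values:
  assumes "k \<le> n"
  shows "finite (I_values Q n k l)"
proof (rule finite_subset)
  show "I_values Q n k l \<subseteq> (\<lambda>i. real i / (n choose k)) ` {..n choose k}"
  proof
    fix x assume "x \<in> I_values Q n k l"
    then obtain V :: "nat set" and E where V: "x = I_prob V E k l" "finite V" "card V = n"
      unfolding I_values_def hypergraph_def by blast
    have "card {S. S \<subseteq> V \<and> card S = k \<and> card {e \<in> E. e \<subseteq> S} = l} \<le> card {S. S \<subseteq> V \<and> card S = k}"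
      using V by (intro card_mono) auto
    then show "x \<in> (\<lambda>i. real i / (n choose k)) ` {..n choose k}"
      using V assms by (auto simp: I_prob_eq n_subsets)
  qed
qed simp

lemma Max_I_values_Suc_le:
  assumes "k \<le> n"
  shows "Max (I_values Q (Suc n) k l) \<le> Max (I_values Q n k l)"
proof -
  define M where "M = Max (I_values Q n k l)"
  have "x \<le> M" if x: "x \<in> I_values Q (Suc n) k l" for x
  proof -
    obtain V :: "nat set" and E where V: "x = I_prob V E k l" "hypergraph V E" "card V = Suc n"
      "\<forall>e\<in>E. Q (card e)"
      using x unfolding I_values_def by blast
    have finV: "finite V" using V(2) by (simp add: hypergraph_def)
    define G where "G = {S. S \<subseteq> V \<and> card S = k \<and> card {e \<in> E. e \<subseteq> S} = l}"
    have finG: "finite G" using finV by (simp add: G_def)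
    have each: "real (card {S \<in> G. v \<notin> S}) \<le> M * (n choose k)" if "v \<in> V" for v
    proof -
      let ?V = "V - {v}" and ?E = "{e \<in> E. v \<notin> e}"
      have c: "card ?V = n" using V(3) that finV by simp
      have "hypergraph ?V ?E" using V(2) unfolding hypergraph_def by auto
      then have "I_prob ?V ?E k l \<in> I_values Q n k l"
        unfolding I_values_def using c V(4) by blast
      then have "I_prob ?V ?E k l \<le> M"
        unfolding M_def using finite_I_values[OF assms] by simp
      moreover have "{S. S \<subseteq> ?V \<and> card S = k \<and> card {e \<in> ?E. e \<subseteq> S} = l} = {S \<in> G. v \<notin> S}"
      proof -
        have E: "{e \<in> E. v \<notin> e \<and> e \<subseteq> S} = {e \<in> E. e \<subseteq> S}" if "v \<notin> S" for S using that by auto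
        have "S \<subseteq> ?V \<and> card S = k \<and> card {e \<in> ?E. e \<subseteq> S} = l \<longleftrightarrow> S \<in> G \<and> v \<notin> S" for S
        proof (cases "v \<in> S")
          case True
          then show ?thesis by blast
        next
          case False
          then have "S \<subseteq> ?V \<longleftrightarrow> S \<subseteq> V" by blast
          then show ?thesis using False by (simp add: G_def E)
        qed
        then show ?thesis by (rule Collect_cong)
      qed
      then have "I_prob ?V ?E k l = card {S \<in> G. v \<notin> S} / (n choose k)"
        using I_prob_eq[of ?V k ?E l] finV c assms by simp
      moreover have "0 < n choose k" using assms by simp
      ultimately show ?thesis by (simp add: pos_divide_le_eq)
    qed
    have "(\<Sum>v\<in>V. card {S \<in> G. v \<notin> S}) = (\<Sum>v\<in>V. \<Sum>S\<in>G. if v \<notin> S then 1 else 0)"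
      using finG by (intro sum.cong) (auto simp: sum.If_cases Int_def)
    also have "\<dots> = (\<Sum>S\<in>G. \<Sum>v\<in>V. if v \<notin> S then 1 else 0)"
      by (rule sum.swap)
    also have "\<dots> = (\<Sum>S\<in>G. Suc n - k)"
    proof (rule sum.cong)
      fix S assume "S \<in> G"
      then have S: "S \<subseteq> V" "card S = k" by (auto simp: G_def)
      have "(\<Sum>v\<in>V. if v \<notin> S then 1 else 0) = card (V - S)"
        using finV by (auto simp: sum.If_cases Int_def intro!: arg_cong[where f = card])
      then show "(\<Sum>v\<in>V. if v \<notin> S then 1 else 0) = Suc n - k"
        using S V(3) finV by (simp add: card_Diff_subset finite_subset)
    qed simp
    finally have count: "(\<Sum>v\<in>V. card {S \<in> G. v \<notin> S}) = card G * (Suc n - k)" by simp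
    have "real (card G * (Suc n - k)) = (\<Sum>v\<in>V. real (card {S \<in> G. v \<notin> S}))"
      by (simp flip: count)
    also have "\<dots> \<le> (\<Sum>v\<in>V. M * (n choose k))"
      by (intro sum_mono each)
    also have "\<dots> = M * real (Suc n * (n choose k))"
      using V(3) by (simp add: algebra_simps)
    also have "Suc n * (n choose k) = (Suc n choose k) * (Suc n - k)"
      using binomial_absorb_comp[of "Suc n" k] by (simp add: mult.commute)
    finally have "real (card G) * real (Suc n - k) \<le> M * real (Suc n choose k) * real (Suc n - k)"
      by (simp only: of_nat_mult mult.assoc)
    then have "real (card G) \<le> M * real (Suc n choose k)"
      using assms by (simp add: mult_le_cancel_right)
    moreover have "0 < Suc n choose k" using assms by simp
    ultimately have "card G / (Suc n choose k) \<le> M" by (simp add: pos_divide_le_eq del: binomial_Suc_Suc)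
    then show ?thesis
      using V(1,3) I_prob_eq[of V k E l] finV assms by (simp add: G_def del: binomial_Suc_Suc)
  qed
  then show ?thesis
    using finite_I_values[of k "Suc n" Q l] I_values_nonempty[of Q "Suc n" k l] assms
    by (simp add: M_def)
qed

lemma convergent_Max_I_values: "convergent (\<lambda>n. Max (I_values Q n k l))"
proof -
  have "decseq (\<lambda>n. Max (I_values Q (n + k) k l))"
    by (intro decseq_SucI) (simp add: Max_I_values_Suc_le)
  moreover have "0 \<le> Max (I_values Q (n + k) k l)" for n
  proof -
    have "Max (I_values Q (n + k) k l) \<in> I_values Q (n + k) k l"
      by (intro Max_in finite_I_values I_values_nonempty) simp
    then show ?thesis unfolding I_values_def I_prob_def by auto
  qed
  ultimately have "convergent (\<lambda>n. Max (I_values Q (n + k) k l))"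
    using decseq_convergent[of _ 0] by (metis convergentI)
  then show ?thesis by (subst (asm) convergent_ignore_initial_segment)
qed

lemma I_unif_tendsto: "(\<lambda>n. I_unif r n k l) \<longlonglongrightarrow> ind_unif r k l"
  unfolding ind_unif_def I_unif_eq using convergent_Max_I_values by (simp add: convergent_LIMSEQ_iff)

lemma I_le_tendsto: "(\<lambda>n. I_le r n k l) \<longlonglongrightarrow> ind_le r k l"
  unfolding ind_le_def I_le_eq using convergent_Max_I_values by (simp add: convergent_LIMSEQ_iff)

end

theory Submission imports Defs begin

text \<open>Pick vertices independently and uniformly one at a time. A \<open>k\<close>-set with exactly \<open>l\<close> edges
  has at least \<open>k - r l\<close> vertices outside all of these edges, so it suffices to bound by \<open>1/e\<close>
  the probability that there are exactly \<open>l\<close> edges both before and after the last step. This event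
  demands that some step creating new edges, and bringing their number to \<open>l\<close>, is followed only by
  steps creating none. As a step creating no edge from a larger set creates none
  from a smaller one, an optimal stopping argument in the style of Bruss' odds theorem applies: if
  \<open>t\<close> is the probability of creating no edge at all, the event has probability at most
  \<open>- t ln t\<close> for \<open>t \<ge> 1/e\<close>, and at most \<open>1/e\<close> otherwise.\<close>

locale finite_hypergraph =
  fixes V :: "'a set" and E :: "'a set set"
  assumes hyp: "hypergraph V E" and nonempty [simp]: "V \<noteq> {}"
begin

definition num_edges :: "'a set \<Rightarrow> nat" where
  "num_edges R = card {e \<in> E. e \<subseteq> R}"

definition idle :: "'a set \<Rightarrow> 'a set" where
  "idle R = {v \<in> V - R. num_edges (insert v R) = num_edges R}"

text \<open>The probability that \<open>m\<close> random vertices added to \<open>R\<close> are all new and create no edge. Drawing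
  a vertex that is already present counts as a failure, since \<open>idle\<close> would otherwise not be antitone.\<close>

fun stay :: "nat \<Rightarrow> 'a set \<Rightarrow> real" where
  "stay 0 R = 1"
| "stay (Suc m) R = (\<Sum>v\<in>idle R. stay m (insert v R)) / card V"

text \<open>The probability that \<open>m + 1\<close> random vertices added to \<open>R\<close> are all new and that there are
  exactly \<open>l\<close> edges both after \<open>m\<close> and after \<open>m + 1\<close> steps.\<close>

fun hit :: "nat \<Rightarrow> nat \<Rightarrow> 'a set \<Rightarrow> real" where
  "hit l 0 R = (if num_edges R = l then card (idle R) / card V else 0)"
| "hit l (Suc m) R = (\<Sum>v\<in>V - R. hit l m (insert v R)) / card V"

section \<open>Edge counts and idle vertices\<close>

lemma finite_V [simp]: "finite V" and finite_E [simp]: "finite E"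
proof -
  show "finite V" using hyp by (simp add: hypergraph_def)
  then show "finite E" using hyp by (auto simp: hypergraph_def intro: finite_subset[of _ "Pow V"])
qed

lemma card_V_pos [simp]: "card V > 0"
  by (simp add: card_gt_0_iff)

lemma finite_idle [simp]: "finite (idle R)"
  by (simp add: idle_def)

lemma num_edges_mono: "A \<subseteq> B \<Longrightarrow> num_edges A \<le> num_edges B"
  unfolding num_edges_def by (intro card_mono) auto

lemma num_edges_insert_eq_iff:
  assumes "v \<notin> R"
  shows "num_edges (insert v R) = num_edges R \<longleftrightarrow> (\<forall>e\<in>E. e \<subseteq> insert v R \<longrightarrow> v \<notin> e)"
proof
  assume "num_edges (insert v R) = num_edges R"
  then have "{e \<in> E. e \<subseteq> R} = {e \<in> E. e \<subseteq> insert v R}"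
    unfolding num_edges_def by (intro card_subset_eq) auto
  then show "\<forall>e\<in>E. e \<subseteq> insert v R \<longrightarrow> v \<notin> e" using assms by blast
next
  assume "\<forall>e\<in>E. e \<subseteq> insert v R \<longrightarrow> v \<notin> e"
  then have "{e \<in> E. e \<subseteq> insert v R} = {e \<in> E. e \<subseteq> R}" by blast
  then show "num_edges (insert v R) = num_edges R" by (simp add: num_edges_def)
qed

text \<open>An edge through \<open>v\<close> inside \<open>insert v A\<close> also lies inside
  \<open>insert v B\<close>, so a vertex completing an edge over \<open>A\<close> completes one over
  \<open>B\<close>, or already lies in \<open>B\<close>.\<close>

lemma idle_antimono:
  assumes "A \<subseteq> B"
  shows "idle B \<subseteq> idle A"
proof
  fix v assume "v \<in> idle B"
  then have v: "v \<in> V" "v \<notin> B" "num_edges (insert v B) = num_edges B" by (auto simp: idle_def)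
  then have "\<forall>e\<in>E. e \<subseteq> insert v A \<longrightarrow> v \<notin> e"
    using assms num_edges_insert_eq_iff by blast
  then show "v \<in> idle A"
    using v assms num_edges_insert_eq_iff[of v A] by (auto simp: idle_def)
qed

section \<open>The stay and hit probabilities and the stopping bound\<close>

lemma stay_nonneg: "0 \<le> stay m R"
  by (induction m arbitrary: R) (auto intro!: divide_nonneg_nonneg sum_nonneg)

lemma stay_antimono: "A \<subseteq> B \<Longrightarrow> stay m B \<le> stay m A"
proof (induction m arbitrary: A B)
  case (Suc m)
  have "(\<Sum>v\<in>idle B. stay m (insert v B)) \<le> (\<Sum>v\<in>idle B. stay m (insert v A))"
    using Suc.prems by (intro sum_mono Suc.IH) auto
  also have "\<dots> \<le> (\<Sum>v\<in>idle A. stay m (insert v A))"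
    using idle_antimono[OF Suc.prems] by (intro sum_mono2) (auto simp: stay_nonneg)
  finally show ?case by (simp add: divide_right_mono)
qed simp

lemma stay_le_1: "stay m R \<le> 1"
proof (induction m arbitrary: R)
  case (Suc m)
  have "(\<Sum>v\<in>idle R. stay m (insert v R)) \<le> (\<Sum>v\<in>idle R. 1)"
    by (intro sum_mono Suc)
  also have "\<dots> \<le> card V" by (auto simp: idle_def intro!: card_mono)
  finally show ?case by (simp add: divide_le_eq)
qed simp

lemma hit_eq_0:
  assumes "num_edges R > l"
  shows "hit l m R = 0"
  using assms
proof (induction m arbitrary: R)
  case (Suc m)
  have "hit l m (insert v R) = 0" for v
    using Suc.prems num_edges_mono[OF subset_insertI, of R v] by (intro Suc.IH) linarith
  then show ?case by simp
qed simp

text \<open>Edges never disappear, so from count \<open>l\<close> any step creating an edge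
  overshoots for good; all \<open>m + 1\<close> steps must be idle.\<close>

lemma hit_eq_stay: "hit l m R = stay (Suc m) R" if "num_edges R = l"
  using that
proof (induction m arbitrary: R)
  case (Suc m)
  have "(\<Sum>v\<in>V - R. hit l m (insert v R)) = (\<Sum>v\<in>idle R. hit l m (insert v R))"
  proof (rule sum.mono_neutral_right)
    show "\<forall>v\<in>V - R - idle R. hit l m (insert v R) = 0"
    proof
      fix v assume "v \<in> V - R - idle R"
      then have "num_edges (insert v R) \<noteq> num_edges R" by (auto simp: idle_def)
      then have "num_edges (insert v R) > l"
        using num_edges_mono[OF subset_insertI, of R v] Suc.prems by linarith
      then show "hit l m (insert v R) = 0" by (rule hit_eq_0)
    qed
  qed (auto simp: idle_def)
  also have "\<dots> = (\<Sum>v\<in>idle R. stay (Suc m) (insert v R))"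
    using Suc by (intro sum.cong) (auto simp: idle_def)
  finally show ?case by simp
qed simp

text \<open>The right-hand side, as a function of \<open>stay m R\<close>, is the tangent at \<open>a\<close> to \<open>- t ln t\<close>;
  quantifying over all tangents replaces an application of Jensen's inequality.\<close>

lemma hit_le_tangent:
  assumes "num_edges R < l" "exp (-1) \<le> a" "a \<le> 1"
  shows "hit l m R \<le> a - stay m R * (1 + ln a)"
  using assms
proof (induction m arbitrary: R a)
  case 0
  have "a > 0" using 0 by (meson exp_gt_zero less_le_trans)
  then show ?case using 0 ln_le_minus_one[of a] by simp
next
  case (Suc m)
  define n where "n = real (card V)"
  have n: "n > 0" by (simp add: n_def)
  have a: "a > 0" using Suc.prems by (meson exp_gt_zero less_le_trans)
  define t where "t = stay (Suc m) R"
  define c where "c = real (card (idle R)) / n"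
  have t: "t * n = (\<Sum>v\<in>idle R. stay m (insert v R))"
    using n by (simp add: t_def n_def)
  have "(\<Sum>v\<in>idle R. stay m (insert v R)) \<le> (\<Sum>v\<in>idle R. 1)"
    by (intro sum_mono stay_le_1)
  then have tc: "t \<le> c" using t n by (simp add: c_def field_simps)
  \<comment> \<open>After a non-idle step, a count still below \<open>l\<close> is handled by the
    induction hypothesis at \<open>exp (-1)\<close>, where the tangent is horizontal. At count
    \<open>l\<close> every remaining step must be idle, which from a larger set is no likelier than
    \<open>t\<close>.\<close>
  have active: "hit l m (insert v R) \<le> max t (exp (-1))" if "v \<in> V - R - idle R" for v
  proof (cases "num_edges (insert v R)" l rule: linorder_cases)
    case less
    then show ?thesis using Suc.IH[of "insert v R" "exp (-1)"] by simp
  next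
    case equal
    then show ?thesis
      using hit_eq_stay[of "insert v R" l m] stay_antimono[of R "insert v R" "Suc m"]
      unfolding t_def by (simp only: le_max_iff_disj) blast
  next
    case greater
    then show ?thesis by (simp add: hit_eq_0 le_max_iff_disj)
  qed
  \<comment> \<open>Idle steps keep the count below \<open>l\<close>, so the induction hypothesis
    applies to them with any common tangent point \<open>b\<close>, chosen later. Redrawn vertices
    of \<open>R\<close> contribute nothing to \<open>hit\<close> and are generously charged like
    non-idle ones.\<close>
  have bound: "hit l (Suc m) R \<le> (1 - c) * max t (exp (-1)) + c * b - t * (1 + ln b)"
    if b: "exp (-1) \<le> b" "b \<le> 1" for b
  proof -
    have "(\<Sum>v\<in>V - R. hit l m (insert v R))
        = (\<Sum>v\<in>V - R - idle R. hit l m (insert v R)) + (\<Sum>v\<in>idle R. hit l m (insert v R))"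
      by (rule sum.subset_diff) (auto simp: idle_def)
    also have "\<dots> \<le> (\<Sum>v\<in>V - R - idle R. max t (exp (-1)))
        + (\<Sum>v\<in>idle R. b - stay m (insert v R) * (1 + ln b))"
      using Suc.prems b
      by (intro add_mono sum_mono active Suc.IH) (auto simp: idle_def)
    also have "\<dots> \<le> (n - card (idle R)) * max t (exp (-1))
        + (card (idle R) * b - t * n * (1 + ln b))"
    proof (intro add_mono)
      have "card (V - R - idle R) \<le> card (V - idle R)" by (intro card_mono) auto
      also have "\<dots> = card V - card (idle R)"
        by (intro card_Diff_subset) (auto simp: idle_def)
      finally have "real (card (V - R - idle R)) \<le> n - card (idle R)"
        using card_mono[of V "idle R"] by (auto simp: n_def idle_def)
      then show "(\<Sum>v\<in>V - R - idle R. max t (exp (-1))) \<le> (n - card (idle R)) * max t (exp (-1))"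
        by (simp add: mult_right_mono le_max_iff_disj)
    qed (simp add: t sum_subtractf sum_distrib_right)
    also have "\<dots> = n * ((1 - c) * max t (exp (-1)) + c * b - t * (1 + ln b))"
      using n by (simp add: c_def field_simps)
    finally show ?thesis using n by (simp add: n_def pos_divide_le_eq mult.commute)
  qed
  have "hit l (Suc m) R \<le> a - t * (1 + ln a)"
  proof (cases "t \<ge> exp (-1)")
    case True
    then have tpos: "t > 0" by (meson exp_gt_zero less_le_trans)
    then have cpos: "c > 0" using tc by simp
    have c1: "c \<le> 1"
      using card_mono[of V "idle R"] n by (auto simp: c_def n_def idle_def)
    \<comment> \<open>\<open>t / c\<close> is the mean of \<open>stay m (insert v R)\<close> over
      the idle vertices \<open>v\<close>, the tangent point that Jensen's inequality would
      use.\<close>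
    have "exp (-1) \<le> t / c"
      using True cpos c1 tpos by (smt (verit) divide_le_cancel le_divide_eq_1_pos frac_le div_by_1)
    moreover have "t / c \<le> 1" using tc cpos by simp
    ultimately have "hit l (Suc m) R \<le> (1 - c) * t + c * (t / c) - t * (1 + ln (t / c))"
      using bound[of "t / c"] True by (simp add: max_def)
    also have "\<dots> = t * (1 - c + ln c) - t * ln t"
      using cpos tpos by (simp add: ln_div algebra_simps)
    also have "\<dots> \<le> - t * ln t"
      using ln_le_minus_one[OF cpos] tpos by (simp add: mult_le_0_iff)
    \<comment> \<open>By concavity, \<open>- t * ln t\<close> lies below its tangent at
      \<open>a\<close>.\<close>
    also have "\<dots> \<le> a - t * (1 + ln a)"
    proof -
      have "t * ln (a / t) \<le> t * (a / t - 1)"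
        using ln_le_minus_one[of "a / t"] a tpos by (intro mult_left_mono) auto
      then show ?thesis using a tpos by (simp add: ln_div algebra_simps)
    qed
    finally show ?thesis .
  next
    case False
    \<comment> \<open>Here \<open>b = exp (-1)\<close> gives the bound \<open>exp (-1)\<close>. The
      tangent at \<open>a\<close> is at least that at the point \<open>exp (-1)\<close>, and being
      non-increasing also at the smaller \<open>t\<close>.\<close>
    have "ln (exp 1 * a) \<le> exp 1 * a - 1" using a by (intro ln_le_minus_one) simp
    then have "exp (-1) * (1 + ln a) \<le> exp (-1) * (exp 1 * a - 1)"
      using a by (intro mult_left_mono) (simp_all add: ln_mult)
    also have "\<dots> = a - exp (-1)" by (simp add: algebra_simps flip: exp_add mult.assoc)
    finally have 1: "exp (-1) * (1 + ln a) \<le> a - exp (-1)" .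
    have "ln (exp (-1)) \<le> ln a" using Suc.prems a by (subst ln_le_cancel_iff) auto
    then have "t * (1 + ln a) \<le> exp (-1) * (1 + ln a)"
      using False by (intro mult_right_mono) auto
    moreover have "hit l (Suc m) R \<le> exp (-1)"
      using bound[of "exp (-1)"] False by (simp add: max_def algebra_simps)
    ultimately show ?thesis using 1 by linarith
  qed
  then show ?case unfolding t_def .
qed

section \<open>From random draws to counting k-sets\<close>

text \<open>\<open>S\<close> is the set reached after \<open>m + 1\<close> draws and
  \<open>w\<close> the last vertex drawn; the order of the other \<open>m\<close> new vertices is
  forgotten.\<close>

definition pairs :: "nat \<Rightarrow> nat \<Rightarrow> 'a set \<Rightarrow> ('a set \<times> 'a) set" where
  "pairs l m R = {(S, w). R \<subseteq> S \<and> S \<subseteq> V \<and> card S = card R + Suc m \<and> w \<in> S - R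
     \<and> num_edges S = l \<and> num_edges (S - {w}) = l}"

lemma finite_pairs [simp]: "finite (pairs l m R)"
  by (rule finite_subset[of _ "Pow V \<times> V"]) (auto simp: pairs_def)

lemma pairs_insert:
  assumes "R \<subseteq> V" "v \<in> V - R"
  shows "pairs l m (insert v R) = {p \<in> pairs l (Suc m) R. v \<in> fst p \<and> v \<noteq> snd p}"
proof -
  have "finite R" using assms(1) by (rule finite_subset) simp
  then show ?thesis using assms by (auto simp: pairs_def)
qed

text \<open>Each pair arises from \<open>fact m\<close> orders of the vertices drawn before
  \<open>w\<close>. In the induction, the first draw can be any of the \<open>Suc m\<close> new
  vertices of \<open>S\<close> other than \<open>w\<close>, so each pair is counted
  \<open>Suc m\<close> times.\<close>

lemma hit_eq_card_pairs:
  assumes "R \<subseteq> V"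
  shows "hit l m R = card (pairs l m R) * fact m / card V ^ Suc m"
  using assms
proof (induction m arbitrary: R)
  case 0
  then have fin: "finite R" using finite_subset[OF _ finite_V] by blast
  have "pairs l 0 R = (if num_edges R = l then (\<lambda>v. (insert v R, v)) ` idle R else {})"
  proof -
    have "(S, w) \<in> pairs l 0 R \<longleftrightarrow> num_edges R = l \<and> w \<in> idle R \<and> S = insert w R" for S w
    proof
      assume p: "(S, w) \<in> pairs l 0 R"
      then have finS: "finite S" using finite_subset[OF _ finite_V] by (auto simp: pairs_def)
      have "insert w R = S"
        using p fin finS by (intro card_subset_eq) (auto simp: pairs_def)
      moreover from this have "S - {w} = R" using p by (auto simp: pairs_def)
      ultimately show "num_edges R = l \<and> w \<in> idle R \<and> S = insert w R"
        using p by (auto simp: pairs_def idle_def)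
    next
      assume "num_edges R = l \<and> w \<in> idle R \<and> S = insert w R"
      then show "(S, w) \<in> pairs l 0 R" using fin 0 by (auto simp: pairs_def idle_def)
    qed
    then show ?thesis by auto
  qed
  moreover have "inj_on (\<lambda>v. (insert v R, v)) (idle R)" by (auto intro: inj_onI)
  ultimately show ?case by (simp add: card_image)
next
  case (Suc m)
  then have fin: "finite R" using finite_subset[OF _ finite_V] by blast
  have "(\<Sum>v\<in>V - R. card (pairs l m (insert v R)))
      = (\<Sum>v\<in>V - R. \<Sum>p\<in>pairs l (Suc m) R. if v \<in> fst p \<and> v \<noteq> snd p then 1 else 0)"
    using Suc.prems by (intro sum.cong refl) (auto simp: pairs_insert sum.If_cases Int_def)
  also have "\<dots> = (\<Sum>p\<in>pairs l (Suc m) R. \<Sum>v\<in>V - R. if v \<in> fst p \<and> v \<noteq> snd p then 1 else 0)"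
    by (rule sum.swap)
  also have "\<dots> = (\<Sum>p\<in>pairs l (Suc m) R. Suc m)"
  proof (rule sum.cong)
    fix p assume "p \<in> pairs l (Suc m) R"
    then obtain S w where p: "p = (S, w)" "R \<subseteq> S" "S \<subseteq> V" "card S = card R + Suc (Suc m)"
      "w \<in> S - R" by (auto simp: pairs_def)
    then have "(V - R) \<inter> {v. v \<in> fst p \<and> v \<noteq> snd p} = S - R - {w}" by auto
    then have "(\<Sum>v\<in>V - R. if v \<in> fst p \<and> v \<noteq> snd p then 1 else 0) = card (S - R - {w})"
      by (simp add: sum.If_cases)
    also have "\<dots> = Suc m"
      using p fin by (simp add: card_Diff_subset)
    finally show "(\<Sum>v\<in>V - R. if v \<in> fst p \<and> v \<noteq> snd p then 1 else 0) = Suc m" .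
  qed simp
  finally have count: "(\<Sum>v\<in>V - R. card (pairs l m (insert v R))) = card (pairs l (Suc m) R) * Suc m"
    by simp
  have "(\<Sum>v\<in>V - R. hit l m (insert v R))
      = (\<Sum>v\<in>V - R. real (card (pairs l m (insert v R)))) * (fact m / card V ^ Suc m)"
    unfolding sum_distrib_right using Suc.prems
    by (intro sum.cong refl) (simp add: Suc.IH)
  also have "\<dots> = real (card (pairs l (Suc m) R) * Suc m) * (fact m / card V ^ Suc m)"
    by (simp only: count flip: of_nat_sum)
  finally show ?case by (simp add: field_simps)
qed

text \<open>The \<open>l\<close> edges inside \<open>S\<close> cover at most \<open>r * l\<close>
  vertices, and removing an uncovered vertex destroys no edge.\<close>

lemma card_isolated_ge:
  assumes "edges_size_le r E" "S \<subseteq> V" "num_edges S = l"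
  shows "card S - r * l \<le> card {w \<in> S. num_edges (S - {w}) = l}"
proof -
  let ?W = "\<Union>{e \<in> E. e \<subseteq> S}"
  have finS: "finite S" using assms(2) by (rule finite_subset) simp
  have "card ?W \<le> (\<Sum>e\<in>{e \<in> E. e \<subseteq> S}. card e)" by (rule card_Union_le_sum_card)
  also have "\<dots> \<le> (\<Sum>e\<in>{e \<in> E. e \<subseteq> S}. r)"
    using assms(1) by (intro sum_mono) (auto simp: edges_size_le_def)
  also have "\<dots> = r * l" using assms(3) by (simp add: num_edges_def)
  finally have "card S - r * l \<le> card S - card ?W" by simp
  also have "\<dots> \<le> card (S - ?W)" by (rule diff_card_le_card_Diff) (auto intro: finite_subset[OF _ finS])
  also have "\<dots> \<le> card {w \<in> S. num_edges (S - {w}) = l}"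
  proof (rule card_mono)
    show "S - ?W \<subseteq> {w \<in> S. num_edges (S - {w}) = l}"
    proof
      fix w assume w: "w \<in> S - ?W"
      then have "{e \<in> E. e \<subseteq> S - {w}} = {e \<in> E. e \<subseteq> S}" by blast
      then show "w \<in> {w \<in> S. num_edges (S - {w}) = l}" using w assms(3) by (simp add: num_edges_def)
    qed
  qed (use finS in simp)
  finally show ?thesis .
qed

lemma card_k_sets_le:
  assumes "edges_size_le r E" "1 \<le> l" "r * l < k"
  shows "card {S. S \<subseteq> V \<and> card S = k \<and> num_edges S = l} * real (k - r * l) * fact (k - 1)
    \<le> exp (-1) * card V ^ k"
proof -
  let ?G = "{S. S \<subseteq> V \<and> card S = k \<and> num_edges S = l}"
  have k: "Suc (k - 1) = k" using assms(3) by simp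
  have "pairs l (k - 1) {} = (SIGMA S:?G. {w \<in> S. num_edges (S - {w}) = l})"
    using k by (auto simp: pairs_def)
  then have "card (pairs l (k - 1) {}) = (\<Sum>S\<in>?G. card {w \<in> S. num_edges (S - {w}) = l})"
    by (simp, subst card_SigmaI) (auto intro: finite_subset[OF _ finite_V])
  moreover have "(\<Sum>S\<in>?G. k - r * l) \<le> \<dots>"
    using card_isolated_ge[OF assms(1)] by (intro sum_mono) auto
  ultimately have "card ?G * (k - r * l) \<le> card (pairs l (k - 1) {})" by simp
  then have "card ?G * real (k - r * l) \<le> card (pairs l (k - 1) {})"
    by (simp flip: of_nat_mult)
  then have "card ?G * real (k - r * l) * fact (k - 1) \<le> real (card (pairs l (k - 1) {})) * fact (k - 1)"
    by (intro mult_right_mono) auto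
  also have "\<dots> = hit l (k - 1) {} * card V ^ k"
    using hit_eq_card_pairs[of "{}" l "k - 1"] k by simp
  also have "\<dots> \<le> exp (-1) * card V ^ k"
  proof (intro mult_right_mono)
    \<comment> \<open>Edges are non-empty, so the process starts with count 0, below
      \<open>l\<close>; the horizontal tangent at \<open>exp (-1)\<close> then bounds
      \<open>hit\<close> without reference to \<open>stay\<close>.\<close>
    have "{e \<in> E. e \<subseteq> {}} = {}" using hyp by (auto simp: hypergraph_def)
    then have "num_edges {} < l" using assms(2) by (simp only: num_edges_def card.empty)
    then show "hit l (k - 1) {} \<le> exp (-1)" using hit_le_tangent[of "{}" l "exp (-1)"] by simp
  qed simp
  finally show ?thesis .
qed

end

text \<open>The extra factor on the left is the probability that \<open>k\<close> independent draws
  are distinct. It converts draws with repetition into uniform \<open>k\<close>-sets.\<close>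

lemma I_prob_mult_le:
  assumes "hypergraph V E" "edges_size_le r E" "1 \<le> l" "r * l < k" "k \<le> card V"
  shows "I_prob V E k l * (real (card V choose k) * fact k / card V ^ k)
    \<le> real k / (real k - real r * real l) * (1 / exp 1)"
proof -
  have "V \<noteq> {}" using assms(4,5) by auto
  then interpret finite_hypergraph V E using assms(1) by unfold_locales
  define g where "g = real (card {S. S \<subseteq> V \<and> card S = k \<and> num_edges S = l})"
  have pos: "real (card V choose k) > 0" using assms(5) by simp
  have I: "I_prob V E k l * real (card V choose k) = g"
    using pos assms(5) by (simp add: I_prob_eq g_def num_edges_def)
  have d: "real (k - r * l) = real k - real r * real l" "real k - real r * real l > 0"
    using assms(4) by (simp_all add: of_nat_diff flip: of_nat_mult)
  have f: "fact k = real k * fact (k - 1)" using assms(4) by (simp add: fact_reduce)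
  have "g * (real k - real r * real l) * fact (k - 1) \<le> exp (-1) * card V ^ k"
    using card_k_sets_le[OF assms(2-4)] unfolding g_def d(1) .
  then have "real k * (g * (real k - real r * real l) * fact (k - 1)) \<le> real k * (exp (-1) * card V ^ k)"
    by (intro mult_left_mono) auto
  then have "g * fact k / card V ^ k \<le> real k / (real k - real r * real l) * (1 / exp 1)"
    using d(2) by (simp add: f field_simps exp_minus)
  then show ?thesis by (simp flip: I add: mult.assoc)
qed

section \<open>Passage to the limit\<close>

lemma binomial_fact_div_power_tendsto_1:
  "(\<lambda>n. real (n choose k) * fact k / real n ^ k) \<longlonglongrightarrow> 1"
proof -
  have "(\<lambda>n. \<Prod>i<k. (1 - real i / real n)) \<longlonglongrightarrow> (\<Prod>i<k. 1 - 0)"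
    by (intro tendsto_prod tendsto_diff tendsto_const lim_const_over_n)
  moreover have "\<forall>\<^sub>F n in sequentially.
      (\<Prod>i<k. (1 - real i / real n)) = real (n choose k) * fact k / real n ^ k"
    using eventually_gt_at_top[of 0]
  proof eventually_elim
    case (elim n)
    have "real (n choose k) * fact k = (\<Prod>i<k. real n - real i)"
      by (simp add: binomial_gbinomial gbinomial_prod_rev atLeast0LessThan)
    then have "real (n choose k) * fact k / real n ^ k = (\<Prod>i<k. (real n - real i) / real n)"
      by (simp add: prod_dividef)
    also have "\<dots> = (\<Prod>i<k. (1 - real i / real n))"
      using elim by (intro prod.cong) (auto simp: field_simps)
    finally show ?case by simp
  qed
  ultimately show ?thesis by (simp add: tendsto_cong)
qed

lemma ind_unif_le_ind_le: "ind_unif r k l \<le> ind_le r k l"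
proof (rule LIMSEQ_le[OF I_unif_tendsto I_le_tendsto])
  have "I_unif r n k l \<le> I_le r n k l" if "n \<ge> k" for n
    unfolding I_unif_eq I_le_eq
  proof (rule Max_mono)
    show "I_values (\<lambda>s. s = r) n k l \<subseteq> I_values (\<lambda>s. s \<le> r) n k l"
      unfolding I_values_def by fastforce
  qed (simp_all add: I_values_nonempty finite_I_values that)
  then show "\<exists>N. \<forall>n\<ge>N. I_unif r n k l \<le> I_le r n k l" by blast
qed

text \<open>The maximum is attained, so the finite bound applies to it; the distinctness factor
  tends to 1 while the right-hand side does not depend on \<open>n\<close>.\<close>

lemma ind_le_le:
  assumes "1 \<le> l" "r * l < k"
  shows "ind_le r k l \<le> real k / (real k - real r * real l) * (1 / exp 1)"
proof (rule LIMSEQ_le_const2)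
  show "(\<lambda>n. I_le r n k l * (real (n choose k) * fact k / real n ^ k)) \<longlonglongrightarrow> ind_le r k l"
    using tendsto_mult[OF I_le_tendsto binomial_fact_div_power_tendsto_1] by simp
  have "I_le r n k l * (real (n choose k) * fact k / real n ^ k)
      \<le> real k / (real k - real r * real l) * (1 / exp 1)" if n: "n \<ge> k" for n
  proof -
    have "I_le r n k l \<in> I_values (\<lambda>s. s \<le> r) n k l"
      unfolding I_le_eq by (intro Max_in finite_I_values I_values_nonempty n)
    then obtain V :: "nat set" and E where "I_le r n k l = I_prob V E k l" "hypergraph V E"
      "card V = n" "edges_size_le r E"
      unfolding I_values_def edges_size_le_def by blast
    then show ?thesis using I_prob_mult_le[of V E r l k] assms n by simp
  qed
  then show "\<exists>N. \<forall>n\<ge>N. I_le r n k l * (real (n choose k) * fact k / real n ^ k)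
      \<le> real k / (real k - real r * real l) * (1 / exp 1)" by blast
qed

theorem theorem1p4:
  fixes r k l :: nat
  assumes "r \<ge> 1" and "k \<ge> 1" and "1 \<le> l" and "real l < real k / real r"
  shows "ind_unif r k l \<le> ind_le r k l
    \<and> ind_le r k l \<le> real k / (real k - real r * real l) * (1 / exp 1)"
proof -
  have "real (r * l) < real k" using assms by (simp add: field_simps)
  then have "r * l < k" by (simp only: of_nat_less_iff)
  then show ?thesis using ind_unif_le_ind_le ind_le_le assms(3) by blast
qed

end
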